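(* For integers $k\ge 0$ put $$\mathcal{S}_k=\int_{0}^{1}x^k \sin\left(2\pi\left\{\frac{1}{x}\right\}\right)dx,\qquad \mathcal{C}_k=\int_{0}^{1}x^k \cos\left(2\pi\left\{\frac{1}{x}\right\}\right)dx.$$ Then, for every integer $n\ge 0$, $$\mathcal{S}_{2n}=\frac{(-1)^{n+1}(2\pi)^{2n+1}}{(2n+1)!}\left(\sum_{j=0}^{n-1}\frac{(-1)^j(2j+1)!}{(2\pi)^{2j+2}}+\operatorname{Ci}(2\pi)\right),$$ $$\mathcal{S}_{2n+1}=\frac{(-1)^n(2\pi)^{2n+2}}{(2n+2)!}\left(\sum_{j=0}^{n}\frac{(-1)^j(2j)!}{(2\pi)^{2j+1}}-\frac{\pi}{2}+\operatorname{Si}(2\pi)\right),$$ $$\mathcal{C}_{2n}=\frac{(-1)^n(2\pi)^{2n+1}}{(2n+1)!}\left(\sum_{j=0}^{n}\frac{(-1)^j(2j)!}{(2\pi)^{2j+1}}-\frac{\pi}{2}+\operatorname{Si}(2\pi)\right),$$ and $$\mathcal{C}_{2n+1}=\frac{(-1)^n(2\pi)^{2n+2}}{(2n+2)!}\left(\sum_{j=0}^{n}\frac{(-1)^j(2j+1)!}{(2\pi)^{2j+2}}+\operatorname{Ci}(2\pi)\right).$$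
   Context: $\{t\}=t-\lfloor t\rfloor$ denotes the fractional part of the real number $t$. The sine integral and cosine integral are $\operatorname{Si}(x)=\int_{0}^{x}\frac{\sin t}{t}\,dt$ and $\operatorname{Ci}(x)=-\int_{x}^{\infty}\frac{\cos t}{t}\,dt$ for $x>0$ (the latter an improper integral). An empty sum is zero. *)

theory Defs
  imports "HOL-Probability.Sinc_Integral"
begin

text \<open>
  The sine integral is the library's \<^const>\<open>Si\<close>. The cosine integral is a conditionally
  convergent improper integral, hence the limit of integrals over compact intervals;
  it is meant for positive arguments, where the limit exists (lemma \<open>tendsto_Ci\<close> below).
\<close>

definition Ci :: "real \<Rightarrow> real" where
  "Ci x = - Lim at_top (\<lambda>b. integral {x..b} (\<lambda>t. cos t / t))"

text \<open>
  The value of the integrands at \<open>x = 0\<close>, where \<open>1 / x = 0\<close> by convention, does not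
  affect the integrals.
\<close>

definition S_int :: "nat \<Rightarrow> real" where
  "S_int k = integral {0..1} (\<lambda>x. x ^ k * sin (2 * pi * frac (1 / x)))"

definition C_int :: "nat \<Rightarrow> real" where
  "C_int k = integral {0..1} (\<lambda>x. x ^ k * cos (2 * pi * frac (1 / x)))"

text \<open>
  Both \<^const>\<open>integral\<close> and \<^const>\<open>Lim\<close> are total; the following lemmas show that the
  integrals and the limit above exist.
\<close>

lemma integrable_bounded_01:
  fixes f :: "real \<Rightarrow> real"
  assumes "f \<in> borel_measurable borel" and "\<And>x. x \<in> {0..1} \<Longrightarrow> \<bar>f x\<bar> \<le> 1"
  shows "f integrable_on {0..1}"
proof (rule measurable_bounded_by_integrable_imp_integrable)
  show "f \<in> borel_measurable (lebesgue_on {0..1})"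
    using assms(1) by (simp add: borel_measurable_if_D measurable_completion measurable_restrict_space1)
  show "(\<lambda>_. 1::real) integrable_on {0..1::real}"
    by (rule integrable_const_ivl)
qed (use assms in auto)

lemma S_int_integrable: "(\<lambda>x. x ^ k * sin (2 * pi * frac (1 / x))) integrable_on {0..1::real}"
proof (rule integrable_bounded_01)
  show "(\<lambda>x::real. x ^ k * sin (2 * pi * frac (1 / x))) \<in> borel_measurable borel"
    unfolding frac_def by measurable
qed (auto simp: abs_mult power_le_one intro!: mult_le_one)

lemma C_int_integrable: "(\<lambda>x. x ^ k * cos (2 * pi * frac (1 / x))) integrable_on {0..1::real}"
proof (rule integrable_bounded_01)
  show "(\<lambda>x::real. x ^ k * cos (2 * pi * frac (1 / x))) \<in> borel_measurable borel"
    unfolding frac_def by measurable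
qed (auto simp: abs_mult power_le_one intro!: mult_le_one)

lemma tendsto_Ci:
  assumes "x > 0"
  shows "((\<lambda>b. integral {x..b} (\<lambda>t. cos t / t)) \<longlongrightarrow> - Ci x) at_top"
proof -
  define g :: "real \<Rightarrow> real" where "g = (\<lambda>t. sin t / t\<^sup>2)"
  have cont_g: "continuous_on {x..b} g" for b
    unfolding g_def using assms by (intro continuous_intros) auto
  have int_powr: "(\<lambda>t. t powr (-2)) integrable_on {x..}"
    using has_integral_powr_to_inf[of "-2" x] assms by (auto intro: has_integral_integrable)
  have g_bound: "norm (g t) \<le> t powr (-2)" if "t \<ge> x" for t
  proof -
    have "t powr (-2) = 1 / t\<^sup>2"
      using that assms by (simp add: powr_minus_divide powr_numeral)
    then show ?thesis
      by (simp add: g_def abs_mult divide_right_mono)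
  qed
  have g_meas: "g \<in> borel_measurable borel"
    unfolding g_def by measurable
  have "g absolutely_integrable_on {x..}"
  proof (rule measurable_bounded_by_integrable_imp_absolutely_integrable)
    show "g \<in> borel_measurable (lebesgue_on {x..})"
      using g_meas by (simp add: measurable_completion measurable_restrict_space1)
    show "(\<lambda>t. t powr (-2)) integrable_on {x..}" by (fact int_powr)
  qed (use g_bound in auto)
  then have "((\<lambda>b. set_lebesgue_integral lebesgue {x..b} g) \<longlongrightarrow>
      set_lebesgue_integral lebesgue {x..} g) at_top"
    by (intro tendsto_set_lebesgue_integral_at_top) auto
  moreover have "set_lebesgue_integral lebesgue {x..b} g = integral {x..b} g" for b
    by (intro set_lebesgue_integral_eq_integral(2) absolutely_integrable_continuous_real cont_g)
  ultimately obtain l where l: "((\<lambda>b. integral {x..b} g) \<longlongrightarrow> l) at_top"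
    by auto
  have eq: "integral {x..b} (\<lambda>t. cos t / t) = sin b / b - sin x / x + integral {x..b} g"
    if "b \<ge> x" for b
  proof -
    have "((\<lambda>t. cos t / t - g t) has_integral (sin b / b - sin x / x)) {x..b}"
      using that assms
      by (intro fundamental_theorem_of_calculus)
         (auto intro!: derivative_eq_intros
               simp: g_def field_simps power2_eq_square simp flip: has_real_derivative_iff_has_vector_derivative)
    moreover have "(g has_integral integral {x..b} g) {x..b}"
      using cont_g integrable_continuous_real by blast
    ultimately have "((\<lambda>t. cos t / t - g t + g t) has_integral
        (sin b / b - sin x / x + integral {x..b} g)) {x..b}"
      by (rule has_integral_add)
    then show ?thesis by (simp add: integral_unique)
  qed
  have "((\<lambda>b::real. sin b / b) \<longlongrightarrow> 0) at_top"
  proof (rule Lim_null_comparison)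
    show "\<forall>\<^sub>F b::real in at_top. norm (sin b / b) \<le> 1 / b"
      using eventually_gt_at_top[of 0] by eventually_elim (simp add: divide_right_mono)
    show "((\<lambda>b::real. 1 / b) \<longlongrightarrow> 0) at_top"
      by (intro tendsto_divide_0[OF tendsto_const] filterlim_at_top_imp_at_infinity filterlim_ident)
  qed
  then have "((\<lambda>b. sin b / b - sin x / x + integral {x..b} g) \<longlongrightarrow> 0 - sin x / x + l) at_top"
    by (intro tendsto_intros l)
  then have "((\<lambda>b. integral {x..b} (\<lambda>t. cos t / t)) \<longlongrightarrow> 0 - sin x / x + l) at_top"
    by (rule Lim_transform_eventually)
       (use eventually_ge_at_top[of x] in \<open>eventually_elim, simp add: eq\<close>)
  then show ?thesis
    unfolding Ci_def by (simp add: tendsto_Lim)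
qed

end

theory Submission
  imports Defs
begin

text \<open>
  Since sine and cosine have period \<open>2 * pi\<close>, the fractional part may be dropped: with
  \<open>a = 2 * pi\<close>, the integrands are \<open>x ^ k * sin (a / x)\<close> and \<open>x ^ k * cos (a / x)\<close>.
  Differentiating \<open>x ^ (k + 2) * sin (a / x)\<close> and \<open>x ^ (k + 2) * cos (a / x)\<close>, which both
  vanish as \<open>x\<close> tends to \<open>0\<close>, gives two recurrences that link the sine integral of exponent
  \<open>k + 1\<close> to the cosine integral of exponent \<open>k\<close> and vice versa
  (\<open>S_int_Suc\<close>, \<open>C_int_Suc\<close>). Exponent \<open>0\<close> has elementary antiderivatives up to the terms
  \<open>Ci (a / x)\<close> and \<open>Si (a / x)\<close>; at \<open>x = 1\<close> these give the transcendental constants, and at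
  \<open>x = 0\<close> the limits of \<open>Ci\<close> and \<open>Si\<close> at infinity, \<open>0\<close> and \<open>pi / 2\<close>
  (\<open>S_int_0\<close>, \<open>C_int_0\<close>). An induction that takes two steps of the recurrences at a time
  finishes the proof; each use of the cosine recurrence contributes one term of a finite sum.
\<close>

section \<open>The cosine integral\<close>

lemma Ci_eq_integral:
  assumes "0 < x" "x \<le> y"
  shows "Ci y = Ci x + integral {x..y} (\<lambda>t. cos t / t)"
proof -
  have split: "integral {x..b} (\<lambda>t. cos t / t) =
      integral {x..y} (\<lambda>t. cos t / t) + integral {y..b} (\<lambda>t. cos t / t)" if "b \<ge> y" for b
    using assms that
    by (intro Henstock_Kurzweil_Integration.integral_combine[symmetric]
          integrable_continuous_real continuous_intros) auto
  have "((\<lambda>b. integral {x..y} (\<lambda>t. cos t / t) + integral {y..b} (\<lambda>t. cos t / t))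
      \<longlongrightarrow> integral {x..y} (\<lambda>t. cos t / t) + - Ci y) at_top"
    using assms by (intro tendsto_intros tendsto_Ci) auto
  then have "((\<lambda>b. integral {x..b} (\<lambda>t. cos t / t))
      \<longlongrightarrow> integral {x..y} (\<lambda>t. cos t / t) + - Ci y) at_top"
    by (rule Lim_transform_eventually[OF _ eventually_mono[OF eventually_ge_at_top[of y]]])
       (rule split[symmetric])
  from tendsto_unique[OF _ this tendsto_Ci[OF assms(1)]] show ?thesis
    by simp
qed

lemma DERIV_Ci:
  assumes "x > 0"
  shows "(Ci has_real_derivative cos x / x) (at x)"
proof -
  \<comment> \<open>Integrating from \<open>x / 2\<close> makes \<open>x\<close> an interior point, so the derivative is two-sided.\<close>
  have "((\<lambda>y. integral {x/2..y} (\<lambda>t. cos t / t)) has_real_derivative cos x / x)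
      (at x within {x/2..x+1})"
    using assms by (intro integral_has_real_derivative continuous_intros) auto
  moreover have "at x within {x/2..x+1} = at x"
    using assms by (intro at_within_interior) auto
  ultimately have "((\<lambda>y. Ci (x/2) + integral {x/2..y} (\<lambda>t. cos t / t))
      has_real_derivative cos x / x) (at x)"
    by (auto intro!: derivative_eq_intros)
  then show ?thesis
    by (rule has_field_derivative_transform_within_open[where S = "{x/2<..}"])
       (use assms in \<open>auto intro: Ci_eq_integral[symmetric]\<close>)
qed

lemma Ci_at_top: "(Ci \<longlongrightarrow> 0) at_top"
proof -
  have "((\<lambda>y. Ci 1 + integral {1..y} (\<lambda>t. cos t / t)) \<longlongrightarrow> Ci 1 + - Ci 1) at_top"
    by (intro tendsto_intros tendsto_Ci) auto
  moreover have "\<forall>\<^sub>F y in at_top. Ci 1 + integral {1..y} (\<lambda>t. cos t / t) = Ci y"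
    using eventually_ge_at_top[of 1] by eventually_elim (rule Ci_eq_integral[symmetric], auto)
  ultimately have "(Ci \<longlongrightarrow> Ci 1 + - Ci 1) at_top"
    by (rule Lim_transform_eventually)
  then show ?thesis
    by simp
qed

section \<open>Integrals of functions oscillating at the origin\<close>

text \<open>
  The antiderivatives below contain the argument \<open>a / x\<close>, which diverges at \<open>0\<close>, yet they have
  limits from the right there. Redefining \<open>F\<close> as \<open>L\<close> to the left of \<open>0\<close> and at \<open>0\<close> itself makes it
  continuous on the closed interval, and the fundamental theorem of calculus needs
  derivatives in the interior only.
\<close>

lemma has_integral_unit_interval_at_right_limit:
  fixes F f :: "real \<Rightarrow> real"
  assumes deriv: "\<And>x. 0 < x \<Longrightarrow> x \<le> 1 \<Longrightarrow> (F has_real_derivative f x) (at x)"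
    and lim: "(F \<longlongrightarrow> L) (at_right 0)"
  shows "(f has_integral (F 1 - L)) {0..1}"
proof -
  define G where "G x = (if x \<le> 0 then L else F x)" for x :: real
  have G_deriv: "(G has_real_derivative f x) (at x)" if "0 < x" "x \<le> 1" for x
    by (rule has_field_derivative_transform_within_open[OF deriv[OF that], where S = "{0<..}"])
       (use that in \<open>auto simp: G_def\<close>)
  have "(G \<longlongrightarrow> L) (at_right 0)"
    using lim by (rule Lim_transform_eventually) (auto simp: G_def eventually_at_filter)
  then have "continuous (at 0 within {0..1}) G"
    by (simp add: continuous_within G_def at_within_Icc_at_right)
  then have "continuous_on {0..1} G"
    unfolding continuous_on_eq_continuous_within
    by (metis G_deriv DERIV_isCont atLeastAtMost_iff continuous_at_imp_continuous_at_within
        order_le_less)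
  then have "(f has_integral (G 1 - G 0)) {0..1}"
    using G_deriv
    by (intro fundamental_theorem_of_calculus_interior)
       (auto simp flip: has_real_derivative_iff_has_vector_derivative)
  then show ?thesis
    by (simp add: G_def)
qed

lemma tendsto_power_Suc_mult_bounded_at_right_0:
  fixes g :: "real \<Rightarrow> real"
  assumes "\<And>x. \<bar>g x\<bar> \<le> 1"
  shows "((\<lambda>x. x ^ Suc k * g x) \<longlongrightarrow> 0) (at_right 0)"
proof (rule Lim_null_comparison)
  show "\<forall>\<^sub>F x in at_right 0. norm (x ^ Suc k * g x) \<le> \<bar>x\<bar> ^ Suc k"
    using assms by (intro always_eventually)
      (auto simp: abs_mult power_abs intro!: mult_left_le simp del: power_Suc)
  show "((\<lambda>x::real. \<bar>x\<bar> ^ Suc k) \<longlongrightarrow> 0) (at_right 0)"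
    by (auto intro!: tendsto_eq_intros)
qed

lemma filterlim_divide_at_right_0:
  fixes a :: real
  assumes "a > 0"
  shows "filterlim (\<lambda>x. a / x) at_top (at_right 0)"
  using filterlim_tendsto_pos_mult_at_top[OF tendsto_const assms filterlim_inverse_at_top_right]
  by (simp add: divide_inverse)

lemma DERIV_const_divide:
  fixes a x :: real
  assumes "x \<noteq> 0"
  shows "((\<lambda>x. a / x) has_real_derivative (- a / x\<^sup>2)) (at x)"
  using assms by (auto intro!: derivative_eq_intros simp: power2_eq_square)

text \<open>
  Differentiating \<open>x * sin (a / x)\<close> leaves an extra term \<open>- a * cos (a / x) / x\<close>. This is
  the derivative of \<open>a * Ci (a / x)\<close>, which vanishes as \<open>x\<close> tends to \<open>0\<close>. The cosine integrand is treated alike with \<open>Si\<close>,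
  whose limit at infinity is \<open>pi / 2\<close>.
\<close>

lemma has_integral_sin_divide:
  assumes "a > 0"
  shows "((\<lambda>x. sin (a / x)) has_integral (sin a - a * Ci a)) {0..1}"
proof -
  define F where "F x = x ^ Suc 0 * sin (a / x) - a * Ci (a / x)" for x :: real
  have "((\<lambda>x. sin (a / x)) has_integral (F 1 - (0 - a * 0))) {0..1}"
  proof (rule has_integral_unit_interval_at_right_limit)
    fix x :: real assume x: "0 < x" "x \<le> 1"
    have inner: "((\<lambda>x. a / x) has_real_derivative (- a / x\<^sup>2)) (at x)"
      using x by (intro DERIV_const_divide) simp
    have outer: "(Ci has_real_derivative cos (a / x) / (a / x)) (at (a / x))"
      using assms x by (intro DERIV_Ci) simp
    have "((\<lambda>x. x * sin (a / x) - a * Ci (a / x)) has_real_derivative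
        (1 * sin (a / x) + cos (a / x) * (- a / x\<^sup>2) * x) -
        a * (cos (a / x) / (a / x) * (- a / x\<^sup>2))) (at x)"
      by (rule DERIV_diff[OF DERIV_mult[OF DERIV_ident DERIV_chain2[OF DERIV_sin inner]]
            DERIV_cmult[OF DERIV_chain2[OF outer inner]]])
    then show "(F has_real_derivative sin (a / x)) (at x)"
      unfolding F_def using assms x by (simp add: power2_eq_square)
  next
    show "(F \<longlongrightarrow> 0 - a * 0) (at_right 0)"
      unfolding F_def
      by (intro tendsto_diff tendsto_mult_left tendsto_power_Suc_mult_bounded_at_right_0
            filterlim_compose[OF Ci_at_top filterlim_divide_at_right_0[OF assms]]) auto
  qed
  then show ?thesis by (simp add: F_def)
qed

lemma has_integral_cos_divide:
  assumes "a > 0"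
  shows "((\<lambda>x. cos (a / x)) has_integral (cos a + a * Si a - a * (pi / 2))) {0..1}"
proof -
  define F where "F x = x ^ Suc 0 * cos (a / x) + a * Si (a / x)" for x :: real
  have "((\<lambda>x. cos (a / x)) has_integral (F 1 - (0 + a * (pi / 2)))) {0..1}"
  proof (rule has_integral_unit_interval_at_right_limit)
    fix x :: real assume x: "0 < x" "x \<le> 1"
    have inner: "((\<lambda>x. a / x) has_real_derivative (- a / x\<^sup>2)) (at x)"
      using x by (intro DERIV_const_divide) simp
    have outer: "(Si has_real_derivative sinc (a / x)) (at (a / x))"
      by (rule DERIV_Si)
    have "((\<lambda>x. x * cos (a / x) + a * Si (a / x)) has_real_derivative
        (1 * cos (a / x) + - sin (a / x) * (- a / x\<^sup>2) * x) +
        a * (sinc (a / x) * (- a / x\<^sup>2))) (at x)"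
      by (rule DERIV_add[OF DERIV_mult[OF DERIV_ident DERIV_chain2[OF DERIV_cos inner]]
            DERIV_cmult[OF DERIV_chain2[OF outer inner]]])
    then show "(F has_real_derivative cos (a / x)) (at x)"
      unfolding F_def using assms x by (simp add: power2_eq_square)
  next
    show "(F \<longlongrightarrow> 0 + a * (pi / 2)) (at_right 0)"
      unfolding F_def
      by (intro tendsto_add tendsto_mult_left tendsto_power_Suc_mult_bounded_at_right_0
            filterlim_compose[OF Si_at_top filterlim_divide_at_right_0[OF assms]]) auto
  qed
  then show ?thesis by (simp add: F_def)
qed

text \<open>
  Integration by parts, stated for the combined integrand that is the derivative of
  \<open>x ^ (k + 2) * sin (a / x)\<close> (and of its cosine analogue): the exponent \<open>k + 2\<close> absorbs the
  factor \<open>1 / x ^ 2\<close> from the inner derivative and makes the boundary term at \<open>0\<close> vanish.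
\<close>

lemma has_integral_power_sin_divide_by_parts:
  "((\<lambda>x. real (k + 2) * (x ^ Suc k * sin (a / x)) - a * (x ^ k * cos (a / x)))
      has_integral sin a) {0..1}"
proof -
  define F where "F x = x ^ Suc (Suc k) * sin (a / x)" for x :: real
  have "((\<lambda>x. real (k + 2) * (x ^ Suc k * sin (a / x)) - a * (x ^ k * cos (a / x)))
      has_integral (F 1 - 0)) {0..1}"
  proof (rule has_integral_unit_interval_at_right_limit)
    fix x :: real assume x: "0 < x" "x \<le> 1"
    then have "((\<lambda>x. a / x) has_real_derivative (- a / x\<^sup>2)) (at x)"
      by (intro DERIV_const_divide) simp
    from DERIV_mult[OF DERIV_pow[of "Suc (Suc k)"] DERIV_chain2[OF DERIV_sin this]]
    show "(F has_real_derivative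
        real (k + 2) * (x ^ Suc k * sin (a / x)) - a * (x ^ k * cos (a / x))) (at x)"
      unfolding F_def using x by (simp add: power2_eq_square algebra_simps)
  next
    show "(F \<longlongrightarrow> 0) (at_right 0)"
      unfolding F_def by (intro tendsto_power_Suc_mult_bounded_at_right_0) simp
  qed
  then show ?thesis by (simp add: F_def)
qed

lemma has_integral_power_cos_divide_by_parts:
  "((\<lambda>x. real (k + 2) * (x ^ Suc k * cos (a / x)) + a * (x ^ k * sin (a / x)))
      has_integral cos a) {0..1}"
proof -
  define F where "F x = x ^ Suc (Suc k) * cos (a / x)" for x :: real
  have "((\<lambda>x. real (k + 2) * (x ^ Suc k * cos (a / x)) + a * (x ^ k * sin (a / x)))
      has_integral (F 1 - 0)) {0..1}"
  proof (rule has_integral_unit_interval_at_right_limit)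
    fix x :: real assume x: "0 < x" "x \<le> 1"
    then have "((\<lambda>x. a / x) has_real_derivative (- a / x\<^sup>2)) (at x)"
      by (intro DERIV_const_divide) simp
    from DERIV_mult[OF DERIV_pow[of "Suc (Suc k)"] DERIV_chain2[OF DERIV_cos this]]
    show "(F has_real_derivative
        real (k + 2) * (x ^ Suc k * cos (a / x)) + a * (x ^ k * sin (a / x))) (at x)"
      unfolding F_def using x by (simp add: power2_eq_square algebra_simps)
  next
    show "(F \<longlongrightarrow> 0) (at_right 0)"
      unfolding F_def by (intro tendsto_power_Suc_mult_bounded_at_right_0) simp
  qed
  then show ?thesis by (simp add: F_def)
qed

section \<open>Recurrences and closed forms\<close>

lemma sin_2pi_frac: "sin (2 * pi * frac t) = sin (2 * pi * t)"
  and cos_2pi_frac: "cos (2 * pi * frac t) = cos (2 * pi * t)"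
proof -
  have "2 * pi * frac t = 2 * pi * t - 2 * pi * of_int \<lfloor>t\<rfloor>"
    by (simp add: frac_def algebra_simps)
  then show "sin (2 * pi * frac t) = sin (2 * pi * t)" "cos (2 * pi * frac t) = cos (2 * pi * t)"
    by (simp_all add: sin_diff cos_diff)
qed

lemma has_integral_S_int: "((\<lambda>x. x ^ k * sin (2 * pi / x)) has_integral S_int k) {0..1}"
proof -
  have "2 * pi / x = 2 * pi * (1 / x)" for x :: real
    by simp
  then show ?thesis
    using integrable_integral[OF S_int_integrable[of k]]
    unfolding S_int_def sin_2pi_frac by (simp only:)
qed

lemma has_integral_C_int: "((\<lambda>x. x ^ k * cos (2 * pi / x)) has_integral C_int k) {0..1}"
proof -
  have "2 * pi / x = 2 * pi * (1 / x)" for x :: real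
    by simp
  then show ?thesis
    using integrable_integral[OF C_int_integrable[of k]]
    unfolding C_int_def cos_2pi_frac by (simp only:)
qed

lemma S_int_0: "S_int 0 = - (2 * pi * Ci (2 * pi))"
proof -
  have "((\<lambda>x. sin (2 * pi / x)) has_integral S_int 0) {0..1}"
    using has_integral_S_int[of 0] by simp
  from has_integral_unique[OF this has_integral_sin_divide] show ?thesis
    by simp
qed

lemma C_int_0: "C_int 0 = 1 + 2 * pi * (Si (2 * pi) - pi / 2)"
proof -
  have "((\<lambda>x. cos (2 * pi / x)) has_integral C_int 0) {0..1}"
    using has_integral_C_int[of 0] by simp
  from has_integral_unique[OF this has_integral_cos_divide] show ?thesis
    by (simp add: right_diff_distrib)
qed

lemma S_int_Suc: "S_int (Suc k) = 2 * pi * C_int k / real (k + 2)"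
proof -
  have "real (k + 2) * S_int (Suc k) - 2 * pi * C_int k = sin (2 * pi)"
    by (rule has_integral_unique[OF
          has_integral_diff[OF has_integral_mult_right[OF has_integral_S_int]
            has_integral_mult_right[OF has_integral_C_int]]
          has_integral_power_sin_divide_by_parts])
  then show ?thesis by (simp add: field_simps)
qed

lemma C_int_Suc: "C_int (Suc k) = (1 - 2 * pi * S_int k) / real (k + 2)"
proof -
  have "real (k + 2) * C_int (Suc k) + 2 * pi * S_int k = cos (2 * pi)"
    by (rule has_integral_unique[OF
          has_integral_add[OF has_integral_mult_right[OF has_integral_C_int]
            has_integral_mult_right[OF has_integral_S_int]]
          has_integral_power_cos_divide_by_parts])
  then show ?thesis by (simp add: field_simps)
qed

lemma closed_form_step_S:
  fixes a s B :: real
  shows "a * (s * a ^ m / fact m * B) / real (m + 1) = s * a ^ (m + 1) / fact (m + 1) * B"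
  by (simp add: field_simps)

text \<open>
  The boundary term \<open>1 / (m + 1)\<close> of the cosine recurrence is absorbed into the bracket as
  the next term of the finite sum. The scalar \<open>s\<close> is a sign, hence its own inverse.
\<close>

lemma closed_form_step_C:
  fixes a s B :: real
  assumes "a \<noteq> 0" "s * s = 1"
  shows "(1 - a * (- s * a ^ m / fact m * B)) / real (m + 1) =
    s * a ^ (m + 1) / fact (m + 1) * (B + s * fact m / a ^ (m + 1))"
proof -
  have "s * a ^ (m + 1) / fact (m + 1) * (s * fact m / a ^ (m + 1)) =
      (s * s) * (a ^ (m + 1) / a ^ (m + 1)) * (fact m / fact (m + 1))"
    by simp
  also have "\<dots> = 1 / real (m + 1)"
    using assms by simp
  finally have "s * a ^ (m + 1) / fact (m + 1) * (s * fact m / a ^ (m + 1)) = 1 / real (m + 1)" .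
  moreover have "a * (- s * a ^ m / fact m * B) / real (m + 1) =
      - (s * a ^ (m + 1) / fact (m + 1) * B)"
    using closed_form_step_S[of a "- s" m B] by simp
  ultimately show ?thesis
    by (simp only: diff_divide_distrib distrib_left)
qed

lemma S_int_Suc_closed_form:
  assumes "C_int k = s * (2 * pi) ^ (k + 1) / fact (k + 1) * B"
  shows "S_int (Suc k) = s * (2 * pi) ^ (k + 2) / fact (k + 2) * B"
  using closed_form_step_S[of "2 * pi" s "k + 1" B] assms by (simp add: S_int_Suc)

lemma C_int_Suc_closed_form:
  assumes "S_int k = - s * (2 * pi) ^ (k + 1) / fact (k + 1) * B" "s * s = 1"
  shows "C_int (Suc k) =
    s * (2 * pi) ^ (k + 2) / fact (k + 2) * (B + s * fact (k + 1) / (2 * pi) ^ (k + 2))"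
  using closed_form_step_C[of "2 * pi" s "k + 1" B] assms by (simp add: C_int_Suc)

theorem theorem1:
  fixes n :: nat
  shows "S_int (2 * n) =
      (- 1) ^ (n + 1) * (2 * pi) ^ (2 * n + 1) / fact (2 * n + 1) *
      ((\<Sum>j<n. (- 1) ^ j * fact (2 * j + 1) / (2 * pi) ^ (2 * j + 2)) + Ci (2 * pi))
    \<and> S_int (2 * n + 1) =
      (- 1) ^ n * (2 * pi) ^ (2 * n + 2) / fact (2 * n + 2) *
      ((\<Sum>j\<le>n. (- 1) ^ j * fact (2 * j) / (2 * pi) ^ (2 * j + 1)) - pi / 2 + Si (2 * pi))
    \<and> C_int (2 * n) =
      (- 1) ^ n * (2 * pi) ^ (2 * n + 1) / fact (2 * n + 1) *
      ((\<Sum>j\<le>n. (- 1) ^ j * fact (2 * j) / (2 * pi) ^ (2 * j + 1)) - pi / 2 + Si (2 * pi))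
    \<and> C_int (2 * n + 1) =
      (- 1) ^ n * (2 * pi) ^ (2 * n + 2) / fact (2 * n + 2) *
      ((\<Sum>j\<le>n. (- 1) ^ j * fact (2 * j + 1) / (2 * pi) ^ (2 * j + 2)) + Ci (2 * pi))"
proof -
  define P where "P n = (\<Sum>j<n. (- 1) ^ j * fact (2 * j + 1) / (2 * pi) ^ (2 * j + 2)) + Ci (2 * pi)"
    for n :: nat
  define Q where "Q n = (\<Sum>j\<le>n. (- 1) ^ j * fact (2 * j) / (2 * pi) ^ (2 * j + 1)) - pi / 2 + Si (2 * pi)"
    for n :: nat
  \<comment> \<open>\<open>P\<close> is the bracket with \<open>Ci\<close>, \<open>Q\<close> the one with \<open>Si\<close>. The sums in \<open>P\<close> are indexed so that
    \<open>P n\<close> belongs to the even sine integral and \<open>P (Suc n)\<close> to the odd cosine integral.\<close>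
  have P_Suc: "P (Suc n) = P n + (- 1) ^ n * fact (2 * n + 1) / (2 * pi) ^ (2 * n + 2)" for n
    unfolding P_def by simp
  have Q_Suc: "Q (Suc n) = Q n + (- 1) ^ Suc n * fact (2 * n + 2) / (2 * pi) ^ (2 * n + 3)" for n
    unfolding Q_def by (simp add: eval_nat_numeral)
  have sign_sq: "(- 1) ^ n * (- 1) ^ n = (1::real)" for n
    by (simp flip: power_mult_distrib)
  have odd_S: "S_int (2 * n + 1) = (- 1) ^ n * (2 * pi) ^ (2 * n + 2) / fact (2 * n + 2) * Q n"
    if "C_int (2 * n) = (- 1) ^ n * (2 * pi) ^ (2 * n + 1) / fact (2 * n + 1) * Q n" for n
    using S_int_Suc_closed_form[OF that] by simp
  have odd_C: "C_int (2 * n + 1) = (- 1) ^ n * (2 * pi) ^ (2 * n + 2) / fact (2 * n + 2) * P (Suc n)"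
    if "S_int (2 * n) = (- 1) ^ (n + 1) * (2 * pi) ^ (2 * n + 1) / fact (2 * n + 1) * P n" for n
    using C_int_Suc_closed_form[of "2 * n" "(- 1) ^ n" "P n"] that sign_sq[of n]
    unfolding P_Suc by simp
  have even: "S_int (2 * n) = (- 1) ^ (n + 1) * (2 * pi) ^ (2 * n + 1) / fact (2 * n + 1) * P n \<and>
      C_int (2 * n) = (- 1) ^ n * (2 * pi) ^ (2 * n + 1) / fact (2 * n + 1) * Q n" for n
  proof (induction n)
    case 0
    show ?case
      by (simp add: P_def Q_def S_int_0 C_int_0 field_simps)
  next
    case (Suc n)
    have "S_int (Suc (2 * n + 1)) =
        (- 1) ^ n * (2 * pi) ^ (2 * n + 1 + 2) / fact (2 * n + 1 + 2) * P (Suc n)"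
      using odd_C[of n] Suc by (intro S_int_Suc_closed_form) simp
    moreover have "C_int (Suc (2 * n + 1)) =
        (- 1) ^ Suc n * (2 * pi) ^ (2 * n + 1 + 2) / fact (2 * n + 1 + 2) *
        (Q n + (- 1) ^ Suc n * fact (2 * n + 1 + 1) / (2 * pi) ^ (2 * n + 1 + 2))"
      using odd_S[of n] Suc sign_sq[of "Suc n"] by (intro C_int_Suc_closed_form) simp_all
    ultimately show ?case
      unfolding Q_Suc by (simp add: eval_nat_numeral)
  qed
  have "(\<Sum>j\<le>n. (- 1) ^ j * fact (2 * j + 1) / (2 * pi) ^ (2 * j + 2)) + Ci (2 * pi) = P (Suc n)"
    unfolding P_def by (simp only: lessThan_Suc_atMost)
  then show ?thesis
    using even[of n] odd_S[of n] odd_C[of n] unfolding P_def[of n] Q_def[of n] by simp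
qed

end
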